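(* Let $M\in\mathbb{C}^{p\times p}$ be nonsingular and let $\mathcal{A}\in\mathbb{C}^{m\times m\times p}$ with $\mathrm{ind}(\mathrm{mat}(\mathcal{A}))=k$. Then $$\mathcal{A}^{\mathrm{cep}}=\mathrm{mat}^{-1}\big(\mathrm{mat}(\mathcal{A})^{\mathrm{cep}}\big),$$ where $(\cdot)^{\mathrm{cep}}$ denotes the core-EP inverse (of a tensor on the left, of a matrix on the right).
   Context: Transform: for $\mathcal{A}\in\mathbb{C}^{m\times n\times p}$, $\tilde{\mathcal{A}}=\mathcal{A}\times_3 M\in\mathbb{C}^{m\times n\times p}$ is given by $(\tilde{\mathcal{A}})_{ijk}=\sum_{s=1}^p(\mathcal{A})_{ijs}M_{ks}$, and $\tilde{\mathcal{A}}^{(i)}=\tilde{\mathcal{A}}(:,:,i)$ is its $i$th frontal slice. Since $M$ is nonsingular, $\mathcal{A}\mapsto\tilde{\mathcal{A}}$ is a bijection. $\mathrm{mat}(\mathcal{A})\in\mathbb{C}^{mp\times np}$ is the block diagonal matrix with diagonal blocks $\tilde{\mathcal{A}}^{(1)},\dots,\tilde{\mathcal{A}}^{(p)}$. For $A\in\mathbb{C}^{mp\times np}$, $\mathrm{mat}^{-1}(A)=\mathcal{B}\times_3M^{-1}$, where $\mathcal{B}(:,:,i)$ is the $i$th $m\times n$ diagonal block of $A$; thus $\mathrm{mat}^{-1}(\mathrm{mat}(\mathcal{A}))=\mathcal{A}$. $M$-product: $\mathcal{A}*_M\mathcal{B}=\mathrm{mat}^{-1}(\mathrm{mat}(\mathcal{A})\,\mathrm{mat}(\mathcal{B}))$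 for $\mathcal{A}\in\mathbb{C}^{m\times n\times p}$, $\mathcal{B}\in\mathbb{C}^{n\times l\times p}$. The identity tensor $\mathcal{I}$ has $\tilde{\mathcal{I}}^{(i)}=I_m$ for all $i$; powers are with respect to $*_M$, with $\mathcal{A}^0=\mathcal{I}$. The conjugate transpose $\mathcal{A}^*$ is the tensor whose transform has $i$th frontal slice $(\tilde{\mathcal{A}}^{(i)})^{*}$ (matrix conjugate transpose). Index: for a square matrix $A$, $\mathrm{ind}(A)$ is the least integer $k\ge 0$ with $\mathrm{rank}(A^k)=\mathrm{rank}(A^{k+1})$. The tubal index of $\mathcal{A}\in\mathbb{C}^{m\times m\times p}$ is $\max_{1\le i\le p}\mathrm{ind}(\tilde{\mathcal{A}}^{(i)})$. Core-EP inverse of a tensor: for $\mathcal{A}\in\mathbb{C}^{m\times m\times p}$ of tubal index $k$, $\mathcal{A}^{\mathrm{cep}}$ is the tensor $\mathcal{X}\in\mathbb{C}^{m\times m\times p}$ satisfying $\mathcal{X}*_M\mathcal{A}^{k+1}=\mathcal{A}^k$, $\mathcal{A}*_M\mathcal{X}^2=\mathcal{X}$ and $(\mathcal{A}*_M\mathcal{X})^*=\mathcal{A}*_M\mathcal{X}$. Core-EP inverse of a matrix: for a square matrix $A$ of index $k$, $A^{\mathrm{cep}}$ is the matrix $X$ with $XA^{k+1}=A^k$, $AX^2=X$ and $(AX)^*=AX$. *)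

theory Defs
  imports
    "Jordan_Normal_Form.Matrix"
    "Jordan_Normal_Form.DL_Rank"
    "Jordan_Normal_Form.Gauss_Jordan_Elimination"
    "Jordan_Normal_Form.Schur_Decomposition"
begin

text \<open>
  A third-order tensor is the list of its frontal slices. All indices start at 0, so the
  entry in row \<open>i\<close>, column \<open>j\<close> of slice \<open>k\<close> of \<open>A\<close> is \<open>A ! k $$ (i, j)\<close>.
\<close>

type_synonym tensor = "complex mat list"

definition carrier_tensor :: "nat \<Rightarrow> nat \<Rightarrow> nat \<Rightarrow> tensor set" where
  "carrier_tensor m n p = {A. length A = p \<and> set A \<subseteq> carrier_mat m n}"

text \<open>These are only meaningful for tensors with at least one frontal slice.\<close>

definition nrows :: "tensor \<Rightarrow> nat" where
  "nrows A = dim_row (A ! 0)"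

definition ncols :: "tensor \<Rightarrow> nat" where
  "ncols A = dim_col (A ! 0)"

definition mode3_prod :: "tensor \<Rightarrow> complex mat \<Rightarrow> tensor" where
  "mode3_prod A M =
     map (\<lambda>k. Matrix.mat (nrows A) (ncols A)
                (\<lambda>(i, j). \<Sum>s<length A. A ! s $$ (i, j) * M $$ (k, s)))
       [0..<dim_row M]"

text \<open>Intended for invertible \<open>M\<close> only; otherwise the value is unspecified.\<close>

definition inv_mat :: "complex mat \<Rightarrow> complex mat" where
  "inv_mat M = the (mat_inverse M)"

definition tmat :: "complex mat \<Rightarrow> tensor \<Rightarrow> complex mat" where
  "tmat M A = diag_block_mat (mode3_prod A M)"

definition diag_blocks :: "nat \<Rightarrow> nat \<Rightarrow> nat \<Rightarrow> complex mat \<Rightarrow> tensor" where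
  "diag_blocks m n p A =
     map (\<lambda>k. Matrix.mat m n (\<lambda>(i, j). A $$ (k * m + i, k * n + j))) [0..<p]"

text \<open>
  The block size \<open>m \<times> n\<close> is an explicit argument; the number of blocks is the size of \<open>M\<close>.
\<close>

definition tmat_inv :: "complex mat \<Rightarrow> nat \<Rightarrow> nat \<Rightarrow> complex mat \<Rightarrow> tensor" where
  "tmat_inv M m n A = mode3_prod (diag_blocks m n (dim_row M) A) (inv_mat M)"

definition tprod :: "complex mat \<Rightarrow> tensor \<Rightarrow> tensor \<Rightarrow> tensor" where
  "tprod M A B = tmat_inv M (nrows A) (ncols B) (tmat M A * tmat M B)"

text \<open>
  The identity tensor and the conjugate transpose are determined by their transforms;
  multiplying by the inverse of \<open>M\<close> recovers the tensor from its transform.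
\<close>

definition tone :: "complex mat \<Rightarrow> nat \<Rightarrow> tensor" where
  "tone M m = mode3_prod (replicate (dim_row M) (1\<^sub>m m)) (inv_mat M)"

fun tpow :: "complex mat \<Rightarrow> tensor \<Rightarrow> nat \<Rightarrow> tensor" where
  "tpow M A 0 = tone M (nrows A)"
| "tpow M A (Suc k) = tprod M (tpow M A k) A"

definition tadjoint :: "complex mat \<Rightarrow> tensor \<Rightarrow> tensor" where
  "tadjoint M A = mode3_prod (map mat_adjoint (mode3_prod A M)) (inv_mat M)"

definition mat_rank :: "complex mat \<Rightarrow> nat" where
  "mat_rank A = vec_space.rank (dim_row A) A"

definition mat_index :: "complex mat \<Rightarrow> nat" where
  "mat_index A = (LEAST k. mat_rank (A ^\<^sub>m k) = mat_rank (A ^\<^sub>m (k + 1)))"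

definition tubal_index :: "complex mat \<Rightarrow> tensor \<Rightarrow> nat" where
  "tubal_index M A = Max (mat_index ` set (mode3_prod A M))"

definition is_mat_cep :: "complex mat \<Rightarrow> complex mat \<Rightarrow> bool" where
  "is_mat_cep A X \<longleftrightarrow>
     (let k = mat_index A in
        X \<in> carrier_mat (dim_row A) (dim_row A) \<and>
        X * A ^\<^sub>m (k + 1) = A ^\<^sub>m k \<and>
        A * X ^\<^sub>m 2 = X \<and>
        mat_adjoint (A * X) = A * X)"

definition mat_cep :: "complex mat \<Rightarrow> complex mat" where
  "mat_cep A = (THE X. is_mat_cep A X)"

definition is_tensor_cep :: "complex mat \<Rightarrow> tensor \<Rightarrow> tensor \<Rightarrow> bool" where
  "is_tensor_cep M A X \<longleftrightarrow>
     (let k = tubal_index M A in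
        X \<in> carrier_tensor (nrows A) (nrows A) (length A) \<and>
        tprod M X (tpow M A (k + 1)) = tpow M A k \<and>
        tprod M A (tpow M X 2) = X \<and>
        tadjoint M (tprod M A X) = tprod M A X)"

definition tensor_cep :: "complex mat \<Rightarrow> tensor \<Rightarrow> tensor" where
  "tensor_cep M A = (THE X. is_tensor_cep M A X)"

end

theory Submission
  imports Defs
begin

text \<open>
  Applying \<open>M\<close> along the third mode and placing the resulting slices on a diagonal embeds the tensors
  into the matrices; products, powers and adjoints go over to those of matrices. Hence a tensor \<open>X\<close>
  solves the core-EP equations for \<open>A\<close> exactly when \<open>tmat M X\<close> solves them for \<open>tmat M A\<close>
  (\<open>is_tensor_cep_iff\<close>), with the tubal index as exponent.

  Two gaps remain. The matrix core-EP inverse of \<open>tmat M A\<close> is defined with the index of that matrix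
  as exponent, and nothing in its definition makes it block diagonal. Both are closed by one fact:
  two solutions of the matrix equations coincide even when they belong to different exponents
  (\<open>core_ep_at_unique\<close>). So it suffices to exhibit one block diagonal solution for the tubal
  index; its blocks are the core-EP inverses of the slices, and the two notions of index never have to
  be compared.

  Both inverses are defined as the unique solution, so existence for a single matrix has to be shown
  (\<open>core_ep_at_exists\<close>). The solution is \<open>A\<^sup>kG\<close>, where \<open>G\<close> is an inner inverse of
  \<open>A\<^sup>k\<^sup>+\<^sup>1\<close> whose product with it is Hermitian. At the index \<open>k\<close> the equality of ranks makes
  \<open>A\<^sup>k\<close> a left and a right multiple of \<open>A\<^sup>k\<^sup>+\<^sup>1\<close>.
\<close>

section \<open>Adjoints and powers of matrices\<close>

lemma mat_adjoint_carrier: "A \<in> carrier_mat n m \<Longrightarrow> mat_adjoint A \<in> carrier_mat m n"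
  by (auto simp: mat_adjoint_def)

lemma dim_mat_adjoint [simp]:
  "dim_row (mat_adjoint A) = dim_col A" "dim_col (mat_adjoint A) = dim_row A"
  by (auto simp: mat_adjoint_def)

lemma index_mat_adjoint [simp]:
  assumes "i < dim_col A" "j < dim_row A"
  shows "mat_adjoint A $$ (i, j) = conjugate (A $$ (j, i))"
  using assms by (simp add: mat_adjoint_def mat_of_rows_index)

lemma mat_adjoint_adjoint: "mat_adjoint (mat_adjoint A) = A"
  by (rule eq_matI) auto

lemma mat_adjoint_mult:
  fixes A B :: "complex mat"
  assumes "A \<in> carrier_mat n m" "B \<in> carrier_mat m l"
  shows "mat_adjoint (A * B) = mat_adjoint B * mat_adjoint A"
  using assms by (intro eq_matI) (auto simp: scalar_prod_def mult.commute intro!: sum.cong)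

text \<open>The diagonal entries of \<open>C\<^sup>*C\<close> are the squared norms of the columns of \<open>C\<close>.\<close>

lemma adjoint_mult_self_eq_zero:
  fixes C :: "complex mat"
  assumes C: "C \<in> carrier_mat n m" and eq: "mat_adjoint C * C = 0\<^sub>m m m"
  shows "C = 0\<^sub>m n m"
proof (rule eq_matI)
  fix i j assume ij: "i < dim_row (0\<^sub>m n m :: complex mat)" "j < dim_col (0\<^sub>m n m :: complex mat)"
  have "complex_of_real (\<Sum>i<n. (cmod (C $$ (i, j)))\<^sup>2) = (mat_adjoint C * C) $$ (j, j)"
    using ij C by (auto simp: scalar_prod_def lessThan_atLeast0 complex_norm_square mult.commute
        simp del: of_real_power intro!: sum.cong)
  also have "\<dots> = 0" using eq ij by simp
  finally have "(\<Sum>i<n. (cmod (C $$ (i, j)))\<^sup>2) = 0" by (simp only: of_real_eq_0_iff)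
  then show "C $$ (i, j) = 0\<^sub>m n m $$ (i, j)"
    using ij by (simp add: sum_nonneg_eq_0_iff)
qed (use C in auto)

lemma pow_mat_add:
  fixes A :: "'a :: semiring_1 mat"
  assumes "A \<in> carrier_mat n n"
  shows "A ^\<^sub>m (i + j) = A ^\<^sub>m i * A ^\<^sub>m j"
proof (induction j)
  case (Suc j)
  then show ?case
    using assms by (simp add: assoc_mult_mat[of _ n n _ n _ n] pow_carrier_mat)
qed (use assms in \<open>simp add: pow_carrier_mat\<close>)

lemma pow_mat_commutes:
  fixes A :: "'a :: semiring_1 mat"
  assumes "A \<in> carrier_mat n n"
  shows "A * A ^\<^sub>m k = A ^\<^sub>m k * A"
  using pow_mat_add[OF assms, of 1 k] pow_mat_add[OF assms, of k 1] assms by simp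

lemma transpose_pow_mat:
  fixes A :: "'a :: comm_semiring_1 mat"
  assumes A: "A \<in> carrier_mat n n"
  shows "transpose_mat (A ^\<^sub>m k) = transpose_mat A ^\<^sub>m k"
proof (induction k)
  case (Suc k)
  have "transpose_mat A \<in> carrier_mat n n" using A by simp
  from pow_mat_commutes[OF this, of k] Suc show ?case
    using A by (simp add: transpose_mult[of _ n n _ n] pow_carrier_mat)
qed (use A in simp)

section \<open>Generalised inverses\<close>

text \<open>
  Reducing to row echelon form writes \<open>A = R * C\<close> with \<open>R\<close> invertible. An echelon form has an
  explicit inner inverse \<open>Q\<close>: it sends the \<open>i\<close>-th unit vector to the one at the \<open>i\<close>-th pivot
  column, so that \<open>C * Q\<close> is the diagonal projection onto the nonzero rows of \<open>C\<close>.
\<close>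

lemma exists_inner_inverse:
  fixes A :: "'a :: field mat"
  assumes A: "A \<in> carrier_mat n n"
  shows "\<exists>G \<in> carrier_mat n n. A * G * A = A"
proof -
  obtain C D where gj: "gauss_jordan A (1\<^sub>m n) = (C, D)" by force
  from gauss_jordan_transform[OF A one_carrier_mat gj, where b = True]
  obtain P where "P \<in> Units (ring_mat TYPE('a) n True)" and CP: "C = P * A" by auto
  then obtain R where P: "P \<in> carrier_mat n n" and R: "R \<in> carrier_mat n n"
    and RP: "R * P = 1\<^sub>m n" by (auto simp: Units_def ring_mat_def)
  have C: "C \<in> carrier_mat n n" using P A CP by simp
  have AR: "A = R * C"
    using A P R RP by (simp add: CP assoc_mult_mat[of _ n n _ n _ n, symmetric])
  from gauss_jordan_row_echelon[OF A gj] C obtain f where piv: "pivot_fun C f n"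
    by (auto simp: row_echelon_form_def)
  from C have "dim_row C = n" by simp
  note pv = pivot_funD[OF this piv]
  define Q :: "'a mat" where "Q = Matrix.mat n n (\<lambda>(j, i). if j = f i then 1 else 0)"
  have Q: "Q \<in> carrier_mat n n" by (simp add: Q_def)
  have CQ: "C * Q = Matrix.mat n n (\<lambda>(i, l). if i = l \<and> f i < n then 1 else 0)"
  proof (rule eq_matI)
    fix i l assume il': "i < dim_row (Matrix.mat n n (\<lambda>(i, l). if i = l \<and> f i < n then 1 else 0 :: 'a))"
      "l < dim_col (Matrix.mat n n (\<lambda>(i, l). if i = l \<and> f i < n then 1 else 0 :: 'a))"
    then have il: "i < n" "l < n" by auto
    have "(C * Q) $$ (i, l) = (\<Sum>j<n. C $$ (i, j) * (if j = f l then 1 else 0))"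
      using C il by (simp add: Q_def scalar_prod_def lessThan_atLeast0)
    also have "\<dots> = (\<Sum>j<n. if j = f l then C $$ (i, j) else 0)"
      by (rule sum.cong) auto
    also have "\<dots> = (if f l < n then C $$ (i, f l) else 0)" by simp
    finally have e: "(C * Q) $$ (i, l) = (if f l < n then C $$ (i, f l) else 0)" .
    show "(C * Q) $$ (i, l) = Matrix.mat n n (\<lambda>(i, l). if i = l \<and> f i < n then 1 else 0) $$ (i, l)"
      using e pv(4,5) il by auto
  qed (use C Q in auto)
  have CQC: "C * Q * C = C"
  proof (rule eq_matI)
    fix i j assume ij: "i < dim_row C" "j < dim_col C"
    then have "(C * Q * C) $$ (i, j) = (\<Sum>l<n. (if i = l \<and> f i < n then 1 else 0) * C $$ (l, j))"
      unfolding CQ using C by (simp add: scalar_prod_def lessThan_atLeast0)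
    also have "\<dots> = (\<Sum>l<n. if l = i then (if f i < n then C $$ (i, j) else 0) else 0)"
      by (rule sum.cong) auto
    also have "\<dots> = C $$ (i, j)"
      using ij C pv(1)[of i] pv(2)[of i j] by (auto simp: not_less)
    finally show "(C * Q * C) $$ (i, j) = C $$ (i, j)" .
  qed (use C Q in auto)
  have "A * (Q * P) * A = R * C * (Q * P) * A" by (simp only: AR[symmetric])
  also have "\<dots> = R * (C * Q * (P * A))"
    using R C Q P A by (simp only: assoc_mult_mat[of _ n n _ n _ n] mult_carrier_mat[of _ n n _ n])
  also have "\<dots> = A" by (simp only: CP[symmetric] CQC AR[symmetric])
  finally have "A * (Q * P) * A = A" .
  then show ?thesis using Q P by (intro bexI[of _ "Q * P"]) auto
qed

text \<open>
  Solving the normal equations makes the projection onto the range orthogonal. Take any inner inverse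
  \<open>H\<close> of \<open>B\<^sup>*B\<close> and put \<open>G = H\<^sup>*B\<^sup>*\<close>; then \<open>B\<^sup>*BG = B\<^sup>*\<close>, because
  \<open>C = BHB\<^sup>*B - B\<close> is a right multiple of \<open>B\<close> killed by \<open>B\<^sup>*\<close>, hence zero. Multiplying by
  \<open>G\<^sup>*\<close> gives \<open>(BG)\<^sup>*(BG) = (BG)\<^sup>*\<close>, so \<open>BG\<close> is Hermitian.
\<close>

lemma exists_inner_inverse_hermitian:
  fixes B :: "complex mat"
  assumes B: "B \<in> carrier_mat n n"
  shows "\<exists>G \<in> carrier_mat n n. B * G * B = B \<and> mat_adjoint (B * G) = B * G"
proof -
  let ?a = mat_adjoint
  have aB: "?a B \<in> carrier_mat n n" using B by (rule mat_adjoint_carrier)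
  note assoc = assoc_mult_mat[of _ n n _ n _ n]
  note carr = mult_carrier_mat[of _ n n _ n] B aB mat_adjoint_carrier[of _ n n]
  note adj = mat_adjoint_mult[of _ n n _ n] mat_adjoint_adjoint
  obtain H where H: "H \<in> carrier_mat n n" and HB: "(?a B * B) * H * (?a B * B) = ?a B * B"
    using exists_inner_inverse[of "?a B * B" n] B aB by auto
  define C where "C = B * H * (?a B * B) - B"
  have C: "C \<in> carrier_mat n n" unfolding C_def using B by (rule minus_carrier_mat)
  have BC: "?a B * C = 0\<^sub>m n n"
  proof -
    have "?a B * C = ?a B * (B * H * (?a B * B)) - ?a B * B"
      unfolding C_def using H by (intro mult_minus_distrib_mat[of _ n n _ n]) (auto simp: carr)
    also have "?a B * (B * H * (?a B * B)) = ?a B * B"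
      using H HB by (simp add: assoc carr)
    finally show ?thesis using B aB by simp
  qed
  have "?a C * C = 0\<^sub>m n n"
  proof -
    define T where "T = H * (?a B * B) - 1\<^sub>m n"
    have T: "T \<in> carrier_mat n n" unfolding T_def by (auto simp: carr H)
    have "C = B * T"
      unfolding C_def T_def using H B aB
      by (subst mult_minus_distrib_mat[of _ n n _ n]) (auto simp: carr assoc right_mult_one_mat[OF B])
    then have "?a C * C = ?a T * (?a B * C)" using T C by (simp add: adj carr assoc)
    then show ?thesis using T by (simp add: BC carr)
  qed
  from adjoint_mult_self_eq_zero[OF C this] have "C = 0\<^sub>m n n" .
  have BHB: "B * H * (?a B * B) = B"
  proof (rule eq_matI)
    fix i j assume ij: "i < dim_row B" "j < dim_col B"
    then have "C $$ (i, j) = 0" using \<open>C = 0\<^sub>m n n\<close> B by simp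
    moreover have "C $$ (i, j) = (B * H * (?a B * B)) $$ (i, j) - B $$ (i, j)"
      unfolding C_def using ij by (intro index_minus_mat) auto
    ultimately show "(B * H * (?a B * B)) $$ (i, j) = B $$ (i, j)" by simp
  qed (use B H aB in auto)
  define G where "G = ?a H * ?a B"
  have G: "G \<in> carrier_mat n n" unfolding G_def using H by (simp add: carr)
  have eq: "?a B * (B * G) = ?a B"
    using arg_cong[OF BHB, of ?a] H by (simp add: adj carr assoc G_def)
  have "?a (B * G) * (B * G) = ?a G * (?a B * (B * G))"
    using G by (simp add: adj carr assoc)
  also have "\<dots> = ?a (B * G)" using G by (simp add: eq adj carr)
  finally have pr: "?a (B * G) * (B * G) = ?a (B * G)" .
  have BG: "B * G \<in> carrier_mat n n" using G by (simp add: carr)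
  have "?a (?a (B * G) * (B * G)) = ?a (B * G) * (B * G)"
    by (simp add: mat_adjoint_mult[of "?a (B * G)" n n "B * G" n] mat_adjoint_adjoint
        mat_adjoint_carrier[OF BG] BG)
  then have herm: "?a (B * G) = B * G"
    unfolding pr by (simp add: mat_adjoint_adjoint)
  have "B * G * B = B"
    using arg_cong[OF eq, of ?a] G herm by (simp add: mat_adjoint_mult[of "?a B" n n "B * G" n] mat_adjoint_adjoint carr)
  with G herm show ?thesis by blast
qed

section \<open>Rank and stabilising powers\<close>

text \<open>
  The column space of \<open>A * B\<close> lies in that of \<open>A\<close>. If the dimensions agree, so do the spaces, and
  the columns of \<open>Z\<close> are preimages under \<open>A * B\<close> of the columns of \<open>A\<close>.
\<close>

lemma rank_mult:
  fixes A B :: "complex mat"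
  assumes A: "A \<in> carrier_mat n n" and B: "B \<in> carrier_mat n n"
  shows rank_mult_le: "mat_rank (A * B) \<le> mat_rank A"
    and rank_mult_eq_imp_factor: "mat_rank (A * B) = mat_rank A \<Longrightarrow> \<exists>Z \<in> carrier_mat n n. A = A * B * Z"
proof -
  interpret V: vec_space "TYPE(complex)" n .
  let ?S = "set (cols (A * B))" and ?T = "set (cols A)"
  have S: "?S \<subseteq> carrier_vec n" and T: "?T \<subseteq> carrier_vec n"
    using A B cols_dim[of "A * B"] cols_dim[of A] by auto
  have AB: "A * B \<in> carrier_mat n n" using A B by simp
  have csA: "V.span ?T = {y \<in> carrier_vec n. \<exists>x\<in>carrier_vec n. A *\<^sub>v x = y}"
    using V.col_space_eq[OF A] A by (simp add: V.col_space_def)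
  have csAB: "V.span ?S = {y \<in> carrier_vec n. \<exists>x\<in>carrier_vec n. (A * B) *\<^sub>v x = y}"
    using V.col_space_eq[OF AB] A B by (simp add: V.col_space_def)
  have sub: "V.span ?S \<subseteq> V.span ?T"
    unfolding csA csAB using A B
    by (auto intro!: bexI[of _ "B *\<^sub>v x" for x])
  obtain U where U: "maximal U (\<lambda>T. T \<subseteq> ?S \<and> V.lin_indpt T)"
    using maximal_exists_superset[of ?S "\<lambda>T. T \<subseteq> ?S \<and> V.lin_indpt T" "{}"]
    by (auto simp: V.lin_dep_def)
  have rAB: "mat_rank (A * B) = card U"
    using V.rank_card_indpt[OF AB U] A by (simp add: mat_rank_def)
  have Uli: "V.lin_indpt U" and US: "U \<subseteq> ?S" using U by (auto simp: maximal_def)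
  have UT: "U \<subseteq> V.span ?T" using US V.in_own_span[of ?S] S sub by auto
  have subm: "submodule class_ring (V.span ?T) V.V"
    using V.span_is_submodule[of ?T] T by simp
  interpret W: vectorspace class_ring "V.vs (V.span ?T)"
    using V.span_is_subspace[of ?T] T by (intro V.subspace_is_vs) auto
  have fd: "W.fin_dim" using V.fin_dim_span[of ?T] T by simp
  have Wli: "W.lin_indpt U" using V.span_li_not_depend(2)[OF UT subm] Uli by simp
  have Uc: "U \<subseteq> carrier (V.vs (V.span ?T))" using UT by simp
  have rA: "mat_rank A = W.dim" using A by (simp add: mat_rank_def V.rank_def)
  show "mat_rank (A * B) \<le> mat_rank A"
    unfolding rAB rA by (rule W.li_le_dim(2)[OF fd Uc Wli])
  assume eq: "mat_rank (A * B) = mat_rank A"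
  have "W.basis U"
    by (rule W.dim_li_is_basis[OF fd _ Uc Wli]) (use W.li_le_dim(1)[OF fd Uc Wli] eq rAB rA in auto)
  then have "V.span U = V.span ?T"
    using V.span_li_not_depend(1)[OF UT subm] by (simp add: W.basis_def)
  moreover have "V.span U \<subseteq> V.span ?S" by (rule V.span_is_monotone[OF US])
  ultimately have sub': "V.span ?T \<subseteq> V.span ?S" by simp
  have "\<exists>x \<in> carrier_vec n. (A * B) *\<^sub>v x = col A j" if "j < n" for j
  proof -
    have "col A j \<in> ?T" using that A by (auto simp: cols_def)
    then have "col A j \<in> V.span ?S" using V.in_own_span[of ?T] T sub' by auto
    then show ?thesis unfolding csAB by simp
  qed
  then obtain z where z: "\<And>j. j < n \<Longrightarrow> z j \<in> carrier_vec n \<and> (A * B) *\<^sub>v z j = col A j"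
    by metis
  define Z where "Z = Matrix.mat n n (\<lambda>(i, j). z j $ i)"
  have colZ: "col Z j = z j" if "j < n" for j
    using that z[of j] by (auto simp: Z_def)
  have "A = A * B * Z"
  proof (rule eq_matI)
    fix i j assume "i < dim_row (A * B * Z)" "j < dim_col (A * B * Z)"
    then have ij: "i < n" "j < n" using A by (auto simp: Z_def)
    have "(A * B * Z) $$ (i, j) = ((A * B) *\<^sub>v z j) $ i"
      using ij A B colZ by (simp add: Z_def)
    then show "A $$ (i, j) = (A * B * Z) $$ (i, j)" using ij z A by simp
  qed (use A in \<open>auto simp: Z_def\<close>)
  then show "\<exists>Z \<in> carrier_mat n n. A = A * B * Z"
    by (intro bexI[of _ Z]) (auto simp: Z_def)
qed

lemma rank_pow_stabilises:
  fixes A :: "complex mat"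
  assumes A: "A \<in> carrier_mat n n"
  shows "\<exists>k. mat_rank (A ^\<^sub>m k) = mat_rank (A ^\<^sub>m (k + 1))"
proof (rule ccontr)
  assume no: "\<not> ?thesis"
  have lt: "mat_rank (A ^\<^sub>m (k + 1)) < mat_rank (A ^\<^sub>m k)" for k
    proof -
    have "mat_rank (A ^\<^sub>m (k + 1)) \<le> mat_rank (A ^\<^sub>m k)"
      using rank_mult_le[of "A ^\<^sub>m k" n A] A by simp
    moreover have "mat_rank (A ^\<^sub>m k) \<noteq> mat_rank (A ^\<^sub>m (k + 1))" using no by blast
    ultimately show ?thesis by simp
  qed
  have "mat_rank (A ^\<^sub>m k) + k \<le> mat_rank (A ^\<^sub>m 0)" for k
  proof (induction k)
    case (Suc k)
    with lt[of k] show ?case by simp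
  qed simp
  from this[of "Suc (mat_rank (A ^\<^sub>m 0))"] show False by simp
qed

lemma pow_eq_pow_Suc_mult:
  fixes A :: "complex mat"
  assumes A: "A \<in> carrier_mat n n"
    and eq: "mat_rank (A ^\<^sub>m k) = mat_rank (A ^\<^sub>m (k + 1))"
  shows "\<exists>Z \<in> carrier_mat n n. A ^\<^sub>m k = A ^\<^sub>m (k + 1) * Z"
  using rank_mult_eq_imp_factor[of "A ^\<^sub>m k" n A] A eq by simp

lemma pow_eq_pow_add_mult:
  fixes A :: "'a :: semiring_1 mat"
  assumes A: "A \<in> carrier_mat n n" and Z: "Z \<in> carrier_mat n n"
    and eq: "A ^\<^sub>m k = A ^\<^sub>m (k + 1) * Z"
  shows "A ^\<^sub>m k = A ^\<^sub>m (k + j) * Z ^\<^sub>m j"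
proof (induction j)
  case (Suc j)
  note carr = A Z mult_carrier_mat[of _ n n _ n]
  note assoc = assoc_mult_mat[of _ n n _ n _ n]
  have "A ^\<^sub>m (k + j) = A ^\<^sub>m j * A ^\<^sub>m k"
    using pow_mat_add[OF A, of j k] by (simp add: add.commute)
  also have "\<dots> = A ^\<^sub>m j * A ^\<^sub>m (k + 1) * Z"
    unfolding eq by (simp only: assoc carr pow_carrier_mat)
  also have "A ^\<^sub>m j * A ^\<^sub>m (k + 1) = A ^\<^sub>m (k + Suc j)"
    using pow_mat_add[OF A, of j "k + 1"] by (simp add: ac_simps)
  finally have "A ^\<^sub>m (k + j) = A ^\<^sub>m (k + Suc j) * Z" .
  with Suc have "A ^\<^sub>m k = A ^\<^sub>m (k + Suc j) * (Z * Z ^\<^sub>m j)"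
    by (simp only: assoc carr pow_carrier_mat)
  then show ?case by (simp only: pow_mat_commutes[OF Z] pow_mat.simps)
qed (use A Z in simp)

text \<open>
  Equality of ranks is a statement about column spaces, so it directly gives right factors only. For the
  left factor the powers of the transpose are used: they stabilise at some exponent \<open>l\<close>, unrelated to
  \<open>k\<close>, and transposing back gives \<open>A\<^sup>l = W A\<^sup>l\<^sup>+\<^sup>1\<close>. Since \<open>A\<^sup>k\<close> is a right multiple of
  \<open>A\<^sup>l\<close>, this relation passes to the exponent \<open>k\<close> with the same \<open>W\<close>.
\<close>

lemma pow_eq_mult_pow_Suc:
  fixes A :: "complex mat"
  assumes A: "A \<in> carrier_mat n n"
    and eq: "mat_rank (A ^\<^sub>m k) = mat_rank (A ^\<^sub>m (k + 1))"
  shows "\<exists>W \<in> carrier_mat n n. A ^\<^sub>m k = W * A ^\<^sub>m (k + 1)"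
proof -
  note carr = A mult_carrier_mat[of _ n n _ n] pow_carrier_mat
  note assoc = assoc_mult_mat[of _ n n _ n _ n]
  let ?T = "transpose_mat A"
  have T: "?T \<in> carrier_mat n n" using A by simp
  obtain l where "mat_rank (?T ^\<^sub>m l) = mat_rank (?T ^\<^sub>m (l + 1))"
    using rank_pow_stabilises[OF T] by blast
  then obtain V where V: "V \<in> carrier_mat n n" and TV: "?T ^\<^sub>m l = ?T ^\<^sub>m (l + 1) * V"
    using pow_eq_pow_Suc_mult[OF T] by blast
  define W where "W = transpose_mat V"
  have W: "W \<in> carrier_mat n n" using V by (simp add: W_def)
  have "A ^\<^sub>m l = transpose_mat (?T ^\<^sub>m l)"
    using transpose_pow_mat[OF T, of l] by simp
  also have "\<dots> = W * A ^\<^sub>m (l + 1)"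
    unfolding TV W_def using transpose_pow_mat[OF T, of "l + 1"] V T
    by (simp add: transpose_mult[of _ n n _ n] del: pow_mat.simps)
  finally have left: "A ^\<^sub>m l = W * A ^\<^sub>m (l + 1)" .
  obtain Z where Z: "Z \<in> carrier_mat n n" and AZ: "A ^\<^sub>m k = A ^\<^sub>m (k + 1) * Z"
    using pow_eq_pow_Suc_mult[OF A eq] by blast
  define Y where "Y = A ^\<^sub>m k * Z ^\<^sub>m l"
  have Y: "Y \<in> carrier_mat n n" using Z by (simp add: Y_def carr)
  have k: "A ^\<^sub>m k = A ^\<^sub>m l * Y"
  proof -
    have "A ^\<^sub>m k = A ^\<^sub>m (l + k) * Z ^\<^sub>m l"
      using pow_eq_pow_add_mult[OF A Z AZ, of l] by (simp add: add.commute)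
    then show ?thesis using Z by (simp only: pow_mat_add[OF A] Y_def assoc carr)
  qed
  have "A ^\<^sub>m k = W * A ^\<^sub>m (l + 1) * Y" using k unfolding left[symmetric] .
  also have "A ^\<^sub>m (l + 1) = A * A ^\<^sub>m l" using pow_mat_commutes[OF A, of l] by simp
  also have "W * (A * A ^\<^sub>m l) * Y = W * (A * (A ^\<^sub>m l * Y))" using W Y by (simp only: assoc carr)
  also have "\<dots> = W * A ^\<^sub>m (k + 1)" using k pow_mat_commutes[OF A, of k] by simp
  finally show ?thesis using W by blast
qed

section \<open>The core-EP inverse of a matrix\<close>

text \<open>
  The exponent is a parameter, instead of being tied to the index of \<open>A\<close>. This makes the equations for
  a block diagonal matrix, for its blocks and for a tensor comparable although the three indices are
  defined differently.
\<close>

definition core_ep_at :: "nat \<Rightarrow> complex mat \<Rightarrow> complex mat \<Rightarrow> bool" where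
  "core_ep_at k A X \<longleftrightarrow>
     X * A ^\<^sub>m (k + 1) = A ^\<^sub>m k \<and> A * X ^\<^sub>m 2 = X \<and> mat_adjoint (A * X) = A * X"

lemma core_ep_at_mono:
  assumes A: "A \<in> carrier_mat n n" and X: "X \<in> carrier_mat n n"
    and core: "core_ep_at k A X" and "k \<le> l"
  shows "core_ep_at l A X"
proof -
  obtain d where l: "l = k + d" using \<open>k \<le> l\<close> by (auto simp: le_iff_add)
  have "X * A ^\<^sub>m (l + 1) = X * (A ^\<^sub>m (k + 1) * A ^\<^sub>m d)"
    using pow_mat_add[OF A, of "k + 1" d] by (simp add: l ac_simps)
  also have "\<dots> = X * A ^\<^sub>m (k + 1) * A ^\<^sub>m d"
    using assoc_mult_mat[of X n n "A ^\<^sub>m (k + 1)" n "A ^\<^sub>m d" n] X pow_carrier_mat[OF A] by metis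
  also have "\<dots> = A ^\<^sub>m l"
    using core by (simp only: core_ep_at_def l pow_mat_add[OF A, of k d])
  finally show ?thesis using core by (simp add: core_ep_at_def)
qed

text \<open>
  The equation \<open>AX\<^sup>2 = X\<close>, iterated: the range of \<open>X\<close> lies in the range of every power of \<open>A\<close>.
\<close>

lemma core_ep_at_eq_pow:
  assumes A: "A \<in> carrier_mat n n" and X: "X \<in> carrier_mat n n" and core: "core_ep_at k A X"
  shows "X = A ^\<^sub>m j * X ^\<^sub>m (j + 1)"
proof (induction j)
  case (Suc j)
  note carr = A X mult_carrier_mat[of _ n n _ n] pow_carrier_mat
  note assoc = assoc_mult_mat[of _ n n _ n _ n]
  have "A * (X * X) = X" using core X by (simp add: core_ep_at_def numeral_2_eq_2)
  then have "X ^\<^sub>m (j + 1) = A * X * X * X ^\<^sub>m j"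
    using pow_mat_commutes[OF X, of j] by (simp add: assoc carr)
  also have "\<dots> = A * (X ^\<^sub>m (j + 2))"
    using pow_mat_add[OF X, of 2 j] by (simp add: assoc carr numeral_2_eq_2)
  finally have "A ^\<^sub>m j * X ^\<^sub>m (j + 1) = A ^\<^sub>m j * A * X ^\<^sub>m (j + 2)"
    by (simp only: assoc carr)
  then have "A ^\<^sub>m j * X ^\<^sub>m (j + 1) = A ^\<^sub>m Suc j * X ^\<^sub>m (Suc j + 1)"
    by (simp only: pow_mat.simps(2) add_2_eq_Suc' add_Suc Suc_eq_plus1[symmetric])
  with Suc show ?case by (rule trans)
qed (use X A in simp)

text \<open>
  Uniqueness holds even across different exponents, since both solutions solve the equations for the
  larger one, \<open>N\<close>. There \<open>AX\<close> and \<open>AY\<close> are orthogonal projections with the same range, that of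
  \<open>A\<^sup>N\<close>, hence equal. Also \<open>XAV = V\<close> for either solution \<open>V\<close>, as \<open>V\<close> has its range in that of
  \<open>A\<^sup>N\<close>; so \<open>X = XAX = XAY = Y\<close>.
\<close>

lemma core_ep_at_unique:
  assumes A: "A \<in> carrier_mat n n" and X: "X \<in> carrier_mat n n" and Y: "Y \<in> carrier_mat n n"
    and cX: "core_ep_at k A X" and cY: "core_ep_at l A Y"
  shows "X = Y"
proof -
  note carr = A X Y mult_carrier_mat[of _ n n _ n] pow_carrier_mat
  note assoc = assoc_mult_mat[of _ n n _ n _ n]
  define N where "N = max k l"
  have *: "U * A * V = V \<and> (A * U) * (A * V) = A * V"
    if U: "U \<in> carrier_mat n n" and V: "V \<in> carrier_mat n n"
      and cU: "core_ep_at N A U" and cV: "core_ep_at N A V" for U V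
  proof -
    have VA: "V = A ^\<^sub>m N * V ^\<^sub>m (N + 1)" by (rule core_ep_at_eq_pow[OF A V cV])
    have "U * A * V = U * A * (A ^\<^sub>m N * V ^\<^sub>m (N + 1))" by (rule arg_cong[OF VA])
    also have "\<dots> = U * (A * A ^\<^sub>m N) * V ^\<^sub>m (N + 1)" using U V by (simp only: assoc carr)
    also have "\<dots> = A ^\<^sub>m N * V ^\<^sub>m (N + 1)"
      using cU pow_mat_commutes[OF A, of N] by (simp add: core_ep_at_def)
    also have "\<dots> = V" by (rule VA[symmetric])
    finally have UAV: "U * A * V = V" .
    have "(A * U) * (A * V) = A * (U * A * V)" using U V by (simp only: assoc carr)
    with UAV show ?thesis by simp
  qed
  have cX: "core_ep_at N A X" and cY: "core_ep_at N A Y"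
    using core_ep_at_mono[OF A X cX, of N] core_ep_at_mono[OF A Y cY, of N] by (auto simp: N_def)
  have hX: "mat_adjoint (A * X) = A * X" and hY: "mat_adjoint (A * Y) = A * Y"
    using cX cY by (auto simp: core_ep_at_def)
  have "A * X = mat_adjoint ((A * Y) * (A * X))" using *[OF Y X cY cX] hX by simp
  also have "\<dots> = (A * X) * (A * Y)"
    using hX hY by (simp add: mat_adjoint_mult[of "A * Y" n n "A * X" n] carr)
  also have "\<dots> = A * Y" using *[OF X Y cX cY] by simp
  finally have "A * X = A * Y" .
  have "X = X * (A * X)" using *[OF X X cX cX] by (simp only: assoc carr)
  also have "\<dots> = X * A * Y" using \<open>A * X = A * Y\<close> by (simp only: assoc carr)
  also have "\<dots> = Y" using *[OF X Y cX cY] by simp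
  finally show ?thesis .
qed

text \<open>
  With \<open>k\<close> the index, \<open>B = A\<^sup>k\<^sup>+\<^sup>1\<close> and \<open>G\<close> an inner inverse of \<open>B\<close> for which \<open>BG\<close> is Hermitian,
  the solution is \<open>X = A\<^sup>kG\<close>: the product \<open>AX = BG\<close> is the orthogonal projection onto the range of
  \<open>B\<close>. The first equation uses that \<open>A\<^sup>k\<close> is a left multiple of \<open>B\<close>, the second that it is a right
  multiple.
\<close>

lemma core_ep_at_exists:
  fixes A :: "complex mat"
  assumes A: "A \<in> carrier_mat n n"
  shows "\<exists>X \<in> carrier_mat n n. core_ep_at (mat_index A) A X"
proof -
  note carr = A mult_carrier_mat[of _ n n _ n] pow_carrier_mat
  note assoc = assoc_mult_mat[of _ n n _ n _ n]
  define k where "k = mat_index A"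
  have stab: "mat_rank (A ^\<^sub>m k) = mat_rank (A ^\<^sub>m (k + 1))"
    unfolding k_def mat_index_def by (rule LeastI_ex[OF rank_pow_stabilises[OF A]])
  define B where "B = A ^\<^sub>m (k + 1)"
  have B: "B \<in> carrier_mat n n" unfolding B_def by (rule pow_carrier_mat[OF A])
  have AB: "A * A ^\<^sub>m k = B" using pow_mat_commutes[OF A, of k] by (simp add: B_def)
  obtain W where W: "W \<in> carrier_mat n n" and kW: "A ^\<^sub>m k = W * B"
    using pow_eq_mult_pow_Suc[OF A stab] by (auto simp: B_def)
  obtain Z where Z: "Z \<in> carrier_mat n n" and kZ: "A ^\<^sub>m k = B * Z"
    using pow_eq_pow_Suc_mult[OF A stab] by (auto simp: B_def)
  obtain G where G: "G \<in> carrier_mat n n" and BGB: "B * G * B = B"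
    and herm: "mat_adjoint (B * G) = B * G"
    using exists_inner_inverse_hermitian[OF B] by blast
  define X where "X = A ^\<^sub>m k * G"
  have X: "X \<in> carrier_mat n n" using G by (simp add: X_def carr)
  have AX: "A * X = B * G" using G by (simp add: X_def AB[symmetric] assoc carr)
  have "X * B = W * (B * G * B)" using W B G by (simp only: X_def kW assoc carr)
  then have "X * B = A ^\<^sub>m k" by (simp add: BGB kW)
  moreover have "A * X ^\<^sub>m 2 = X"
  proof -
    have "A * X ^\<^sub>m 2 = A * X * X" using X by (simp add: numeral_2_eq_2 assoc carr)
    also have "\<dots> = (B * G * B) * Z * G" using B G Z
      by (simp only: AX) (simp only: X_def kZ assoc carr)
    also have "\<dots> = X" by (simp add: BGB X_def kZ)
    finally show ?thesis .
  qed
  ultimately have "core_ep_at k A X" using herm AX by (simp add: core_ep_at_def B_def)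
  then show ?thesis using X k_def by blast
qed

lemma is_mat_cep_iff:
  "is_mat_cep A X \<longleftrightarrow> X \<in> carrier_mat (dim_row A) (dim_row A) \<and> core_ep_at (mat_index A) A X"
  by (simp add: is_mat_cep_def core_ep_at_def Let_def)

text \<open>
  A solution for any exponent is the core-EP inverse, so the index of \<open>A\<close> need not be computed.
\<close>

lemma mat_cep_eqI:
  assumes A: "A \<in> carrier_mat n n" and X: "X \<in> carrier_mat n n" and core: "core_ep_at k A X"
  shows "mat_cep A = X"
proof -
  have eq: "Y = X" if "Y \<in> carrier_mat n n" "core_ep_at (mat_index A) A Y" for Y
    by (rule core_ep_at_unique[OF A that(1) X that(2) core])
  obtain Y where Y: "Y \<in> carrier_mat n n" "core_ep_at (mat_index A) A Y"
    using core_ep_at_exists[OF A] by blast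
  have dim: "dim_row A = n" using A by simp
  show ?thesis
    unfolding mat_cep_def
  proof (rule the_equality)
    show "is_mat_cep A X"
      using Y eq[OF Y] X by (simp add: is_mat_cep_iff dim)
    show "Z = X" if "is_mat_cep A Z" for Z
      using that eq[of Z] by (simp add: is_mat_cep_iff dim)
  qed
qed

section \<open>Mode-3 products\<close>

lemma carrier_tensorD:
  assumes "A \<in> carrier_tensor m n p"
  shows "length A = p" and "k < p \<Longrightarrow> A ! k \<in> carrier_mat m n"
  using assms by (auto simp: carrier_tensor_def)

lemma carrier_tensor_dims:
  assumes "A \<in> carrier_tensor m n p" "0 < p"
  shows "nrows A = m" "ncols A = n"
  using carrier_tensorD(2)[OF assms] by (auto simp: nrows_def ncols_def)

lemma tensor_eqI:
  assumes A: "A \<in> carrier_tensor m n p" and B: "B \<in> carrier_tensor m n p"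
    and eq: "\<And>k i j. k < p \<Longrightarrow> i < m \<Longrightarrow> j < n \<Longrightarrow> A ! k $$ (i, j) = B ! k $$ (i, j)"
  shows "A = B"
proof (rule nth_equalityI)
  show "length A = length B" using carrier_tensorD(1)[OF A] carrier_tensorD(1)[OF B] by simp
  fix k assume "k < length A"
  then have k: "k < p" using carrier_tensorD(1)[OF A] by simp
  show "A ! k = B ! k"
    using carrier_tensorD(2)[OF A k] carrier_tensorD(2)[OF B k] eq[OF k] by (intro eq_matI) auto
qed

lemma mode3_prod_carrier:
  assumes "A \<in> carrier_tensor m n p" "0 < p" "M \<in> carrier_mat q p"
  shows "mode3_prod A M \<in> carrier_tensor m n q"
  using assms carrier_tensor_dims[OF assms(1,2)] by (auto simp: mode3_prod_def carrier_tensor_def)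

lemma mode3_prod_index:
  assumes "A \<in> carrier_tensor m n p" "0 < p" "M \<in> carrier_mat q p" "k < q" "i < m" "j < n"
  shows "mode3_prod A M ! k $$ (i, j) = (\<Sum>s<p. A ! s $$ (i, j) * M $$ (k, s))"
  using assms carrier_tensor_dims[OF assms(1,2)] carrier_tensorD(1)[OF assms(1)]
  by (auto simp: mode3_prod_def)

lemma mode3_prod_mode3_prod:
  assumes A: "A \<in> carrier_tensor m n p" and p: "0 < p" and q: "0 < q"
    and M: "M \<in> carrier_mat q p" and N: "N \<in> carrier_mat r q"
  shows "mode3_prod (mode3_prod A M) N = mode3_prod A (N * M)"
proof (rule tensor_eqI)
  have AM: "mode3_prod A M \<in> carrier_tensor m n q" by (rule mode3_prod_carrier[OF A p M])
  have NM: "N * M \<in> carrier_mat r p" using N M by simp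
  show "mode3_prod (mode3_prod A M) N \<in> carrier_tensor m n r" by (rule mode3_prod_carrier[OF AM q N])
  show "mode3_prod A (N * M) \<in> carrier_tensor m n r" by (rule mode3_prod_carrier[OF A p NM])
  fix k i j assume kij: "k < r" "i < m" "j < n"
  have "mode3_prod (mode3_prod A M) N ! k $$ (i, j) =
      (\<Sum>t<q. (\<Sum>s<p. A ! s $$ (i, j) * M $$ (t, s)) * N $$ (k, t))"
    using kij by (simp add: mode3_prod_index[OF AM q N] mode3_prod_index[OF A p M])
  also have "\<dots> = (\<Sum>s<p. \<Sum>t<q. A ! s $$ (i, j) * (N $$ (k, t) * M $$ (t, s)))"
    by (subst sum.swap) (simp add: sum_distrib_right sum_distrib_left ac_simps)
  also have "\<dots> = mode3_prod A (N * M) ! k $$ (i, j)"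
    using kij M N by (simp add: mode3_prod_index[OF A p NM] scalar_prod_def lessThan_atLeast0
        sum_distrib_left)
  finally show "mode3_prod (mode3_prod A M) N ! k $$ (i, j) = mode3_prod A (N * M) ! k $$ (i, j)" .
qed

lemma mode3_prod_one:
  assumes A: "A \<in> carrier_tensor m n p" and p: "0 < p"
  shows "mode3_prod A (1\<^sub>m p) = A"
proof (rule tensor_eqI[OF mode3_prod_carrier[OF A p one_carrier_mat] A])
  fix k i j assume kij: "k < p" "i < m" "j < n"
  have "mode3_prod A (1\<^sub>m p) ! k $$ (i, j) = (\<Sum>s<p. if s = k then A ! s $$ (i, j) else 0)"
    unfolding mode3_prod_index[OF A p one_carrier_mat kij] using kij by (intro sum.cong) auto
  then show "mode3_prod A (1\<^sub>m p) ! k $$ (i, j) = A ! k $$ (i, j)" using kij by simp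
qed

lemma inv_mat_inverse:
  assumes M: "M \<in> carrier_mat p p" and inv: "invertible_mat M"
  shows "inv_mat M \<in> carrier_mat p p" "M * inv_mat M = 1\<^sub>m p" "inv_mat M * M = 1\<^sub>m p"
proof -
  obtain N where MN: "M * N = 1\<^sub>m p" and NM: "N * M = 1\<^sub>m (dim_row N)"
    using inv M by (auto simp: invertible_mat_def inverts_mat_def)
  have "dim_col N = p" using arg_cong[OF MN, of dim_col] by simp
  moreover have "dim_row N = p" using arg_cong[OF NM, of dim_col] M by simp
  ultimately have N: "N \<in> carrier_mat p p" and NM: "N * M = 1\<^sub>m p" using NM by auto
  have "M \<in> Units (ring_mat TYPE(complex) p True)"
    using M N MN NM by (auto simp: Units_def ring_mat_def)
  then obtain B where "mat_inverse M = Some B"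
    using mat_inverse(1)[OF M, where b = True] by (cases "mat_inverse M") auto
  then show "inv_mat M \<in> carrier_mat p p" "M * inv_mat M = 1\<^sub>m p" "inv_mat M * M = 1\<^sub>m p"
    using mat_inverse(2)[OF M] by (auto simp: inv_mat_def)
qed

section \<open>Block diagonal matrices\<close>

lemma diag_block_mat_carrier:
  assumes "set As \<subseteq> carrier_mat m n"
  shows "diag_block_mat As \<in> carrier_mat (length As * m) (length As * n)"
  using assms by (induction As) (auto simp: Let_def)

lemma diag_block_mat_index:
  assumes "set As \<subseteq> carrier_mat m n" "k < length As" "i < m" "j < n"
  shows "diag_block_mat As $$ (k * m + i, k * n + j) = As ! k $$ (i, j)"
  using assms
proof (induction As arbitrary: k)
  case (Cons A As)
  have D: "diag_block_mat As \<in> carrier_mat (length As * m) (length As * n)"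
    using Cons.prems by (intro diag_block_mat_carrier) auto
  have A: "A \<in> carrier_mat m n" using Cons.prems by auto
  show ?case
  proof (cases k)
    case 0
    then show ?thesis using Cons.prems A D by (simp add: Let_def)
  next
    case (Suc l)
    have bound: "l * m + i < length As * m" "l * n + j < length As * n"
    proof -
      have *: "l * c + a < length As * c" if "a < c" for a c
        using mult_le_mono1[of "Suc l" "length As" c] that Cons.prems(2) Suc by simp
      show "l * m + i < length As * m" "l * n + j < length As * n"
        using *[of i m] *[of j n] Cons.prems by auto
    qed
    have "diag_block_mat As $$ (l * m + i, l * n + j) = As ! l $$ (i, j)"
      using Cons Suc by auto
    then show ?thesis using Suc A D bound by (simp add: Let_def)
  qed
qed simp

lemma diag_blocks_diag_block_mat:
  assumes A: "As \<in> carrier_tensor m n p"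
  shows "diag_blocks m n p (diag_block_mat As) = As"
  using assms
  by (intro tensor_eqI[of _ m n p]) (auto simp: diag_blocks_def carrier_tensor_def diag_block_mat_index)

lemma diag_block_mat_mult:
  assumes "length As = length Bs"
    and "set As \<subseteq> carrier_mat m n" "set Bs \<subseteq> carrier_mat n l"
  shows "diag_block_mat As * diag_block_mat Bs = diag_block_mat (map2 (*) As Bs :: 'a :: semiring_0 mat list)"
  using assms
proof (induction As Bs rule: list_induct2)
  case (Cons A As B Bs)
  have A: "A \<in> carrier_mat m n" and B: "B \<in> carrier_mat n l" using Cons.prems by auto
  let ?p = "length As"
  have DA: "diag_block_mat As \<in> carrier_mat (?p * m) (?p * n)"
    using Cons.prems by (intro diag_block_mat_carrier) auto
  have DB: "diag_block_mat Bs \<in> carrier_mat (?p * n) (?p * l)"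
    unfolding Cons.hyps using Cons.prems by (intro diag_block_mat_carrier) auto
  have IH: "diag_block_mat As * diag_block_mat Bs = diag_block_mat (map2 (*) As Bs)"
    using Cons by auto
  have DAB: "diag_block_mat (map2 (*) As Bs) \<in> carrier_mat (?p * m) (?p * l)"
    unfolding IH[symmetric] using DA DB by simp
  show ?case
    using A B DA DB DAB
    by (simp add: Let_def IH mult_four_block_mat[OF A zero_carrier_mat zero_carrier_mat DA B
          zero_carrier_mat zero_carrier_mat DB])
qed simp

lemma diag_block_mat_adjoint:
  "mat_adjoint (diag_block_mat As) = diag_block_mat (map mat_adjoint As)"
proof (induction As)
  case (Cons A As)
  let ?D = "diag_block_mat As"
  have "mat_adjoint (diag_block_mat (A # As)) =
      four_block_mat (mat_adjoint A) (0\<^sub>m (dim_col A) (dim_row ?D))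
        (0\<^sub>m (dim_col ?D) (dim_row A)) (mat_adjoint ?D)"
    by (rule eq_matI) (auto simp: Let_def)
  also have "\<dots> = diag_block_mat (map mat_adjoint (A # As))"
    by (simp add: Let_def Cons[symmetric])
  finally show ?case .
qed (auto intro: eq_matI)

lemma core_ep_at_diag_block_mat:
  assumes A: "As \<in> carrier_tensor m m p" and X: "Xs \<in> carrier_tensor m m p"
    and core: "\<And>i. i < p \<Longrightarrow> core_ep_at k (As ! i) (Xs ! i)"
  shows "core_ep_at k (diag_block_mat As) (diag_block_mat Xs)"
proof -
  have len: "length As = p" "length Xs = p" and As: "set As \<subseteq> carrier_mat m m" and Xs: "set Xs \<subseteq> carrier_mat m m"
    using A X by (auto simp: carrier_tensor_def)
  have sq: "Ball (set As) square_mat" "Ball (set Xs) square_mat" using As Xs by auto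
  note mult = diag_block_mat_mult[of _ _ m m m]
  have "diag_block_mat Xs * diag_block_mat As ^\<^sub>m (k + 1) =
      diag_block_mat (map2 (*) Xs (map (\<lambda>B. B ^\<^sub>m (k + 1)) As))"
    unfolding diag_block_pow_mat[OF sq(1)] using len As Xs
    by (intro mult) (auto simp del: pow_mat.simps simp: subset_iff)
  also have "map2 (*) Xs (map (\<lambda>B. B ^\<^sub>m (k + 1)) As) = map (\<lambda>B. B ^\<^sub>m k) As"
    using core len by (intro nth_equalityI) (auto simp del: pow_mat.simps simp: core_ep_at_def)
  finally have 1: "diag_block_mat Xs * diag_block_mat As ^\<^sub>m (k + 1) = diag_block_mat As ^\<^sub>m k"
    unfolding diag_block_pow_mat[OF sq(1)] .
  have "diag_block_mat As * diag_block_mat Xs ^\<^sub>m 2 =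
      diag_block_mat (map2 (*) As (map (\<lambda>B. B ^\<^sub>m 2) Xs))"
    unfolding diag_block_pow_mat[OF sq(2)] using len As Xs
    by (intro mult) (auto simp: subset_iff)
  also have "map2 (*) As (map (\<lambda>B. B ^\<^sub>m 2) Xs) = Xs"
    using core len by (intro nth_equalityI) (auto simp: core_ep_at_def)
  finally have 2: "diag_block_mat As * diag_block_mat Xs ^\<^sub>m 2 = diag_block_mat Xs" .
  have AX: "diag_block_mat As * diag_block_mat Xs = diag_block_mat (map2 (*) As Xs)"
    using len As Xs by (intro mult) auto
  have "map mat_adjoint (map2 (*) As Xs) = map2 (*) As Xs"
    using core len by (intro nth_equalityI) (auto simp: core_ep_at_def)
  then have 3: "mat_adjoint (diag_block_mat As * diag_block_mat Xs) = diag_block_mat As * diag_block_mat Xs"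
    unfolding AX diag_block_mat_adjoint by (rule arg_cong)
  show ?thesis using 1 2 3 by (simp add: core_ep_at_def)
qed

section \<open>Tensors as block diagonal matrices\<close>

text \<open>
  Tensors without slices are excluded because their slice dimensions cannot be read off. For the others
  the facts below say that \<open>tmat M\<close> is an injective homomorphism, for product, powers and
  adjoint, onto the block diagonal matrices.
\<close>

locale nonsingular_transform =
  fixes M :: "complex mat" and p :: nat
  assumes M: "M \<in> carrier_mat p p" and inv: "invertible_mat M" and p: "0 < p"
begin

lemmas inv_M = inv_mat_inverse[OF M inv]

lemma transform_inverse:
  assumes "L \<in> carrier_tensor m n p"
  shows "mode3_prod (mode3_prod L (inv_mat M)) M = L" "mode3_prod (mode3_prod L M) (inv_mat M) = L"
  using mode3_prod_mode3_prod[OF assms p p] M inv_M mode3_prod_one[OF assms p] by auto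

lemma inverse_transform_carrier:
  "L \<in> carrier_tensor m n p \<Longrightarrow> mode3_prod L (inv_mat M) \<in> carrier_tensor m n p"
  by (rule mode3_prod_carrier[OF _ p inv_M(1)])

lemma transform_carrier:
  "L \<in> carrier_tensor m n p \<Longrightarrow> mode3_prod L M \<in> carrier_tensor m n p"
  by (rule mode3_prod_carrier[OF _ p M])

lemma tmat_inverse_transform:
  "L \<in> carrier_tensor m n p \<Longrightarrow> tmat M (mode3_prod L (inv_mat M)) = diag_block_mat L"
  by (simp add: tmat_def transform_inverse)

lemma tmat_carrier:
  assumes "A \<in> carrier_tensor m n p"
  shows "tmat M A \<in> carrier_mat (p * m) (p * n)"
  using transform_carrier[OF assms] diag_block_mat_carrier[of "mode3_prod A M" m n]
  by (auto simp: tmat_def carrier_tensor_def)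

lemma tmat_inv_diag_block_mat:
  assumes "L \<in> carrier_tensor m n p"
  shows "tmat_inv M m n (diag_block_mat L) = mode3_prod L (inv_mat M)"
  using assms M by (simp add: tmat_inv_def diag_blocks_diag_block_mat)

lemma tmat_inv_tmat:
  assumes "A \<in> carrier_tensor m n p"
  shows "tmat_inv M m n (tmat M A) = A"
  using tmat_inv_diag_block_mat[OF transform_carrier[OF assms]] transform_inverse(2)[OF assms]
  by (simp add: tmat_def)

lemma tmat_eq_iff:
  assumes "A \<in> carrier_tensor m n p" "B \<in> carrier_tensor m n p"
  shows "tmat M A = tmat M B \<longleftrightarrow> A = B"
  using tmat_inv_tmat[OF assms(1)] tmat_inv_tmat[OF assms(2)] by metis

lemma tmat_tprod:
  assumes A: "A \<in> carrier_tensor m n p" and B: "B \<in> carrier_tensor n l p"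
  shows "tprod M A B \<in> carrier_tensor m l p" "tmat M (tprod M A B) = tmat M A * tmat M B"
proof -
  let ?L = "map2 (*) (mode3_prod A M) (mode3_prod B M)"
  note tA = transform_carrier[OF A] and tB = transform_carrier[OF B]
  have L: "?L \<in> carrier_tensor m l p"
    using tA tB by (force simp: carrier_tensor_def dest: set_zip_leftD set_zip_rightD)
  have eq: "tmat M A * tmat M B = diag_block_mat ?L"
    unfolding tmat_def using tA tB by (intro diag_block_mat_mult) (auto simp: carrier_tensor_def)
  have "tprod M A B = mode3_prod ?L (inv_mat M)"
    unfolding tprod_def eq carrier_tensor_dims[OF A p] carrier_tensor_dims[OF B p]
    by (rule tmat_inv_diag_block_mat[OF L])
  with L show "tprod M A B \<in> carrier_tensor m l p" "tmat M (tprod M A B) = tmat M A * tmat M B"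
    by (auto simp: inverse_transform_carrier tmat_inverse_transform eq)
qed

lemma tmat_tone:
  shows "tone M m \<in> carrier_tensor m m p" "tmat M (tone M m) = 1\<^sub>m (p * m)"
proof -
  have L: "replicate p (1\<^sub>m m) \<in> carrier_tensor m m p" by (auto simp: carrier_tensor_def)
  have "diag_block_mat (replicate p (1\<^sub>m m)) = (1\<^sub>m (p * m) :: complex mat)"
    using diag_block_one_mat[of "replicate p (1\<^sub>m m :: complex mat)"]
    by (simp add: sum_list_replicate)
  then show "tone M m \<in> carrier_tensor m m p" "tmat M (tone M m) = 1\<^sub>m (p * m)"
    using M inverse_transform_carrier[OF L] tmat_inverse_transform[OF L] by (auto simp: tone_def)
qed

lemma tmat_tpow:
  assumes A: "A \<in> carrier_tensor m m p"
  shows "tpow M A k \<in> carrier_tensor m m p \<and> tmat M (tpow M A k) = tmat M A ^\<^sub>m k"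
proof (induction k)
  case 0
  show ?case using tmat_tone[of m] carrier_tensor_dims[OF A p] tmat_carrier[OF A] by simp
next
  case (Suc k)
  then have IH: "tpow M A k \<in> carrier_tensor m m p" "tmat M (tpow M A k) = tmat M A ^\<^sub>m k" by auto
  then show ?case using tmat_tprod[OF IH(1) A] by simp
qed

lemma tmat_tadjoint:
  assumes A: "A \<in> carrier_tensor m n p"
  shows "tadjoint M A \<in> carrier_tensor n m p" "tmat M (tadjoint M A) = mat_adjoint (tmat M A)"
proof -
  have L: "map mat_adjoint (mode3_prod A M) \<in> carrier_tensor n m p"
    using transform_carrier[OF A] by (auto simp: carrier_tensor_def intro!: mat_adjoint_carrier)
  show "tadjoint M A \<in> carrier_tensor n m p" "tmat M (tadjoint M A) = mat_adjoint (tmat M A)"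
    using inverse_transform_carrier[OF L] tmat_inverse_transform[OF L]
    by (auto simp: tadjoint_def tmat_def[of M A] diag_block_mat_adjoint)
qed

section \<open>Core-EP inverses of tensors\<close>

text \<open>
  As \<open>tmat M\<close> is injective and preserves all operations involved, each defining equation holds for
  tensors exactly when it holds for their images.
\<close>

lemma is_tensor_cep_iff:
  assumes A: "A \<in> carrier_tensor m m p"
  shows "is_tensor_cep M A X \<longleftrightarrow>
    X \<in> carrier_tensor m m p \<and> core_ep_at (tubal_index M A) (tmat M A) (tmat M X)"
proof (cases "X \<in> carrier_tensor m m p")
  case X: True
  let ?k = "tubal_index M A"
  note pw = tmat_tpow[THEN conjunct1] tmat_tpow[THEN conjunct2]
  have "tprod M X (tpow M A (?k + 1)) = tpow M A ?k \<longleftrightarrow>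
      tmat M X * tmat M A ^\<^sub>m (?k + 1) = tmat M A ^\<^sub>m ?k"
    using tmat_eq_iff[OF tmat_tprod(1)[OF X pw(1)[OF A]] pw(1)[OF A]] tmat_tprod(2)[OF X pw(1)[OF A]]
    by (simp only: pw(2)[OF A])
  moreover have "tprod M A (tpow M X 2) = X \<longleftrightarrow> tmat M A * tmat M X ^\<^sub>m 2 = tmat M X"
    using tmat_eq_iff[OF tmat_tprod(1)[OF A pw(1)[OF X]] X] tmat_tprod(2)[OF A pw(1)[OF X]]
    by (simp only: pw(2)[OF X])
  moreover have "tadjoint M (tprod M A X) = tprod M A X \<longleftrightarrow>
      mat_adjoint (tmat M A * tmat M X) = tmat M A * tmat M X"
    using tmat_eq_iff[OF tmat_tadjoint(1) tmat_tprod(1), OF tmat_tprod(1), OF A X A X] tmat_tadjoint(2)[OF tmat_tprod(1)[OF A X]]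
    by (simp only: tmat_tprod(2)[OF A X])
  ultimately show ?thesis
    using X carrier_tensor_dims[OF A p] carrier_tensorD(1)[OF A]
    by (simp only: is_tensor_cep_def core_ep_at_def Let_def)
qed (use carrier_tensor_dims[OF A p] carrier_tensorD(1)[OF A] in \<open>simp add: is_tensor_cep_def Let_def\<close>)

text \<open>
  The core-EP inverse of \<open>tmat M A\<close> is not block diagonal by definition. It is so because the blockwise
  core-EP inverses form a block diagonal solution (for the tubal index, which is at least the index of each
  block), and solutions are unique.
\<close>

lemma tensor_cep_eq:
  assumes A: "A \<in> carrier_tensor m m p"
  shows "tensor_cep M A = tmat_inv M m m (mat_cep (tmat M A))"
proof -
  let ?k = "tubal_index M A" and ?As = "mode3_prod A M"
  note tA = transform_carrier[OF A] and DA = tmat_carrier[OF A]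
  have "\<exists>X \<in> carrier_mat m m. core_ep_at ?k (?As ! i) X" if i: "i < p" for i
  proof -
    have Ai: "?As ! i \<in> carrier_mat m m" by (rule carrier_tensorD(2)[OF tA i])
    have "mat_index (?As ! i) \<le> ?k"
      unfolding tubal_index_def using i carrier_tensorD(1)[OF tA] by (intro Max_ge) auto
    then show ?thesis using core_ep_at_exists[OF Ai] core_ep_at_mono[OF Ai] by blast
  qed
  then obtain x where x: "\<And>i. i < p \<Longrightarrow> x i \<in> carrier_mat m m \<and> core_ep_at ?k (?As ! i) (x i)"
    by metis
  define L where "L = map x [0..<p]"
  have L: "L \<in> carrier_tensor m m p" using x by (auto simp: L_def carrier_tensor_def)
  define X where "X = mode3_prod L (inv_mat M)"
  have X: "X \<in> carrier_tensor m m p" and DX: "tmat M X = diag_block_mat L"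
    using inverse_transform_carrier[OF L] tmat_inverse_transform[OF L] by (auto simp: X_def)
  have core: "core_ep_at ?k (tmat M A) (tmat M X)"
    unfolding DX tmat_def[of M A] using x by (intro core_ep_at_diag_block_mat[OF tA L]) (auto simp: L_def)
  have "tensor_cep M A = X"
    unfolding tensor_cep_def is_tensor_cep_iff[OF A]
  proof (rule the_equality)
    fix Y assume Y: "Y \<in> carrier_tensor m m p \<and> core_ep_at ?k (tmat M A) (tmat M Y)"
    then have "tmat M Y = tmat M X"
      using core_ep_at_unique[OF DA _ _ _ core] tmat_carrier X by blast
    then show "Y = X" using tmat_eq_iff X Y by blast
  qed (use X core in simp)
  moreover have "mat_cep (tmat M A) = tmat M X"
    by (rule mat_cep_eqI[OF DA tmat_carrier[OF X] core])
  ultimately show ?thesis using tmat_inv_tmat[OF X] by simp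
qed

end

theorem proposition4p2:
  fixes M :: "complex mat" and A :: tensor and m p k :: nat
  assumes "M \<in> carrier_mat p p" and "invertible_mat M"
    and "A \<in> carrier_tensor m m p"
    and "mat_index (tmat M A) = k"
  shows "tensor_cep M A = tmat_inv M m m (mat_cep (tmat M A))"
proof (cases "p = 0")
  case False
  then interpret nonsingular_transform M p using assms by unfold_locales auto
  show ?thesis by (rule tensor_cep_eq[OF assms(3)])
next
  case True
  \<comment> \<open>Every tensor that occurs has no slices, so both sides are the empty list.\<close>
  note inv_M = inv_mat_inverse[OF assms(1,2)]
  have nil: "mode3_prod L (inv_mat M) = []" for L
    using inv_M(1) True by (simp add: mode3_prod_def)
  have tprod_nil: "tprod M B C = []" for B C by (simp add: tprod_def tmat_inv_def nil)
  have tpow_nil: "tpow M B j = []" for B j by (cases j) (simp_all add: tprod_nil tone_def nil)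
  have A: "A = []" using assms(3) True by (simp add: carrier_tensor_def)
  have "is_tensor_cep M A X \<longleftrightarrow> X = []" for X
    by (auto simp: is_tensor_cep_def carrier_tensor_def A tprod_nil tpow_nil tadjoint_def nil Let_def
        simp del: tpow.simps)
  then show ?thesis by (simp add: tensor_cep_def tmat_inv_def nil)
qed

end
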